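(* Let $A\in M_{m\times n}(H)$ and $B\in M_{n\times p}(H)$ be commutative quaternion matrices, and let $i\in\{1,2,3\}$. Then: (I) $(A^{(i)})^T=(A^T)^{(i)}$; (II) $(AB)^{\dagger_i}=B^{\dagger_i}A^{\dagger_i}$; (III) $(AB)^T=B^TA^T$; (IV) $(AB)^{(i)}=A^{(i)}B^{(i)}$; (V) if $A$ and $B$ are invertible (in particular square, $m=n=p$), then $(AB)^{-1}=B^{-1}A^{-1}$; (VI) if $A$ is invertible (in particular $m=n$), then $(A^{\dagger_i})^{-1}=(A^{-1})^{\dagger_i}$; (VII) if $A$ is invertible (in particular $m=n$), then $(A^{(i)})^{-1}=(A^{-1})^{(i)}$; (VIII) for $i,j,k\in\{1,2,3\}$: $(A^{(i)})^{(j)}=A^{(k)}$ if $i,j,k$ are pairwise distinct, and $(A^{(i)})^{(j)}=A$ if $i=j$.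
   Context: The commutative quaternions are the real algebra $H=\{q=t+\mathbf{i}x+\mathbf{j}y+\mathbf{k}z : t,x,y,z\in\mathbb{R}\}$ with $\mathbb{R}$-basis $1,\mathbf{i},\mathbf{j},\mathbf{k}$ and commutative bilinear multiplication determined by $\mathbf{i}^2=\mathbf{k}^2=-1$, $\mathbf{j}^2=1$, $\mathbf{i}\mathbf{j}\mathbf{k}=-1$, $\mathbf{i}\mathbf{j}=\mathbf{j}\mathbf{i}=\mathbf{k}$, $\mathbf{j}\mathbf{k}=\mathbf{k}\mathbf{j}=\mathbf{i}$, $\mathbf{k}\mathbf{i}=\mathbf{i}\mathbf{k}=-\mathbf{j}$. The three principal conjugates of $q$ are $q^{(1)}=t-\mathbf{i}x+\mathbf{j}y-\mathbf{k}z$, $q^{(2)}=t+\mathbf{i}x-\mathbf{j}y-\mathbf{k}z$, $q^{(3)}=t-\mathbf{i}x-\mathbf{j}y+\mathbf{k}z$. $M_{m\times n}(H)$ is the set of $m\times n$ matrices with entries in $H$, with ordinary matrix addition and multiplication, and $M_n(H)=M_{n\times n}(H)$. For $A=(a_{rs})\in M_{m\times n}(H)$ and $i\in\{1,2,3\}$: $A^{(i)}=(a_{rs}^{(i)})$ is the $i$-th conjugate, $A^T$ is the transpose, and $A^{\dagger_i}=(A^{(i)})^T$ is the $i$-th conjugate transpose. A square matrix $A\in M_n(H)$ is invertible if $AB=BA=I$ for some $B\in M_n(H)$; then $A^{-1}=B$. *)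

theory Defs
  imports "HOL-Analysis.Analysis"
begin

section \<open>Commutative quaternions\<close>

text \<open>\<open>CQuat t x y z\<close> is the commutative quaternion \<open>t + i x + j y + k z\<close>.\<close>

codatatype cquat = CQuat (cq_t: real) (cq_x: real) (cq_y: real) (cq_z: real)

lemma cquat_eq_iff:
  "p = q \<longleftrightarrow> cq_t p = cq_t q \<and> cq_x p = cq_x q \<and> cq_y p = cq_y q \<and> cq_z p = cq_z q"
  by (auto intro: cquat.expand)

text \<open>
  The product below is the bilinear extension of the multiplication table of the units,
  which is recovered in \<open>cq_units_mult\<close>.
\<close>

instantiation cquat :: comm_ring_1
begin

primcorec zero_cquat where
  "cq_t 0 = 0"
| "cq_x 0 = 0"
| "cq_y 0 = 0"
| "cq_z 0 = 0"

primcorec one_cquat where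
  "cq_t 1 = 1"
| "cq_x 1 = 0"
| "cq_y 1 = 0"
| "cq_z 1 = 0"

primcorec plus_cquat where
  "cq_t (p + q) = cq_t p + cq_t q"
| "cq_x (p + q) = cq_x p + cq_x q"
| "cq_y (p + q) = cq_y p + cq_y q"
| "cq_z (p + q) = cq_z p + cq_z q"

primcorec uminus_cquat where
  "cq_t (- p) = - cq_t p"
| "cq_x (- p) = - cq_x p"
| "cq_y (- p) = - cq_y p"
| "cq_z (- p) = - cq_z p"

primcorec minus_cquat where
  "cq_t (p - q) = cq_t p - cq_t q"
| "cq_x (p - q) = cq_x p - cq_x q"
| "cq_y (p - q) = cq_y p - cq_y q"
| "cq_z (p - q) = cq_z p - cq_z q"

primcorec times_cquat where
  "cq_t (p * q) = cq_t p * cq_t q - cq_x p * cq_x q + cq_y p * cq_y q - cq_z p * cq_z q"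
| "cq_x (p * q) = cq_t p * cq_x q + cq_x p * cq_t q + cq_y p * cq_z q + cq_z p * cq_y q"
| "cq_y (p * q) = cq_t p * cq_y q + cq_y p * cq_t q - cq_z p * cq_x q - cq_x p * cq_z q"
| "cq_z (p * q) = cq_t p * cq_z q + cq_z p * cq_t q + cq_x p * cq_y q + cq_y p * cq_x q"

instance
  by standard (simp_all add: cquat_eq_iff algebra_simps)

end

instantiation cquat :: real_algebra_1
begin

primcorec scaleR_cquat where
  "cq_t (scaleR r q) = r * cq_t q"
| "cq_x (scaleR r q) = r * cq_x q"
| "cq_y (scaleR r q) = r * cq_y q"
| "cq_z (scaleR r q) = r * cq_z q"

instance
  by standard (simp_all add: cquat_eq_iff algebra_simps)

end

definition cq_i :: cquat where "cq_i = CQuat 0 1 0 0"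
definition cq_j :: cquat where "cq_j = CQuat 0 0 1 0"
definition cq_k :: cquat where "cq_k = CQuat 0 0 0 1"

lemma CQuat_eq: "CQuat t x y z = of_real t + cq_i * of_real x + cq_j * of_real y + cq_k * of_real z"
  by (simp add: cquat_eq_iff of_real_def cq_i_def cq_j_def cq_k_def)

lemma cq_units_mult:
  "cq_i * cq_i = - 1" "cq_j * cq_j = 1" "cq_k * cq_k = - 1" "cq_i * cq_j * cq_k = - 1"
  "cq_i * cq_j = cq_k" "cq_j * cq_i = cq_k"
  "cq_j * cq_k = cq_i" "cq_k * cq_j = cq_i"
  "cq_k * cq_i = - cq_j" "cq_i * cq_k = - cq_j"
  by (simp_all add: cquat_eq_iff cq_i_def cq_j_def cq_k_def)

section \<open>Conjugates\<close>

text \<open>The principal conjugates are indexed by 1, 2, 3; other indices carry no meaning.\<close>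

definition cq_conj :: "nat \<Rightarrow> cquat \<Rightarrow> cquat" where
  "cq_conj i q =
    (if i = 1 then CQuat (cq_t q) (- cq_x q) (cq_y q) (- cq_z q)
     else if i = 2 then CQuat (cq_t q) (cq_x q) (- cq_y q) (- cq_z q)
     else if i = 3 then CQuat (cq_t q) (- cq_x q) (- cq_y q) (cq_z q)
     else undefined)"

definition mat_conj :: "nat \<Rightarrow> cquat ^ 'n ^ 'm \<Rightarrow> cquat ^ 'n ^ 'm" where
  "mat_conj i A = (\<chi> r s. cq_conj i (A $ r $ s))"

definition mat_dagger :: "nat \<Rightarrow> cquat ^ 'n ^ 'm \<Rightarrow> cquat ^ 'm ^ 'n" where
  "mat_dagger i A = transpose (mat_conj i A)"

end

theory Submission
  imports Defs
begin

text \<open>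
  Each principal conjugation changes the sign of two of the three imaginary units, and since
  the sign of \<open>k = i j\<close> is always the product of the signs of \<open>i\<close> and \<open>j\<close>, it is a
  unital ring endomorphism of the commutative quaternions. Entrywise application of a unital
  ring endomorphism respects matrix products and the unit matrix (\<open>mat_conj_mult\<close>,
  \<open>mat_conj_one\<close>); transposition reverses products because the entries commute; and
  \<open>\<dagger>\<^sub>i\<close> is the composite of the two. This settles the product rules.

  The three statements about inverses have a single source: over any ring a two-sided inverse
  is unique (\<open>matrix_inv_unique\<close>). A map that preserves or reverses products and fixes the
  unit matrix sends \<open>C\<close> and its inverse to two matrices that are inverse to each other, so the
  image of the inverse is the inverse of the image.

  Finally, the identity and the three conjugations form the Klein four-group: each conjugation is an involution, and
  the composite of two different ones is the third.
\<close>

section \<open>Two-sided inverses of matrices\<close>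

lemma matrix_inv_inverse:
  fixes A :: "'a::semiring_1 ^ 'n ^ 'm"
  assumes "invertible A"
  shows "A ** matrix_inv A = mat 1" and "matrix_inv A ** A = mat 1"
proof -
  have "A ** matrix_inv A = mat 1 \<and> matrix_inv A ** A = mat 1"
    using someI_ex[OF assms[unfolded invertible_def]] by (simp add: matrix_inv_def)
  then show "A ** matrix_inv A = mat 1" and "matrix_inv A ** A = mat 1" by auto
qed

text \<open>
  The usual monoid argument \<open>X = X (A B) = (X A) B = B\<close>, with \<open>X\<close> the inverse
  that \<open>matrix_inv\<close> selects.
\<close>

lemma matrix_inv_unique:
  fixes A :: "'a::semiring_1 ^ 'n ^ 'm"
  assumes AB: "A ** B = mat 1" and BA: "B ** A = mat 1"
  shows "invertible A" and "matrix_inv A = B"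
proof -
  show inv: "invertible A" using AB BA by (auto simp: invertible_def)
  have "matrix_inv A = matrix_inv A ** (A ** B)" by (simp add: AB)
  also have "\<dots> = B" by (simp add: matrix_mul_assoc matrix_inv_inverse(2)[OF inv])
  finally show "matrix_inv A = B" .
qed

lemma matrix_inv_mult:
  fixes A :: "'a::semiring_1 ^ 'n ^ 'm" and B :: "'a ^ 'p ^ 'n"
  assumes A: "invertible A" and B: "invertible B"
  shows "invertible (A ** B)" and "matrix_inv (A ** B) = matrix_inv B ** matrix_inv A"
proof -
  have AB: "(A ** B) ** (matrix_inv B ** matrix_inv A) = mat 1"
    by (metis A B matrix_inv_inverse(1) matrix_mul_assoc matrix_mul_rid)
  have BA: "(matrix_inv B ** matrix_inv A) ** (A ** B) = mat 1"
    by (metis A B matrix_inv_inverse(2) matrix_mul_assoc matrix_mul_rid)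
  show "invertible (A ** B)" and "matrix_inv (A ** B) = matrix_inv B ** matrix_inv A"
    using matrix_inv_unique[OF AB BA] by auto
qed

section \<open>Conjugation as a ring endomorphism\<close>

lemma cq_conj_0:
  assumes "i \<in> {1, 2, 3}"
  shows "cq_conj i 0 = 0"
  using assms by (auto simp: cq_conj_def cquat_eq_iff)

lemma cq_conj_1:
  assumes "i \<in> {1, 2, 3}"
  shows "cq_conj i 1 = 1"
  using assms by (auto simp: cq_conj_def cquat_eq_iff)

lemma cq_conj_add:
  assumes "i \<in> {1, 2, 3}"
  shows "cq_conj i (p + q) = cq_conj i p + cq_conj i q"
  using assms by (auto simp: cq_conj_def cquat_eq_iff)

lemma cq_conj_mult:
  assumes "i \<in> {1, 2, 3}"
  shows "cq_conj i (p * q) = cq_conj i p * cq_conj i q"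
  using assms by (auto simp: cq_conj_def cquat_eq_iff)

lemma cq_conj_sum:
  assumes "i \<in> {1, 2, 3}"
  shows "cq_conj i (sum f S) = (\<Sum>s\<in>S. cq_conj i (f s))"
  using sum_comp_morphism[of "cq_conj i" f S] assms by (simp add: cq_conj_0 cq_conj_add o_def)

lemma cq_conj_involution:
  assumes "i \<in> {1, 2, 3}"
  shows "cq_conj i (cq_conj i q) = q"
  using assms by (auto simp: cq_conj_def cquat_eq_iff)

text \<open>
  The product of two different sign patterns among \<open>(-,+,-)\<close>, \<open>(+,-,-)\<close>,
  \<open>(-,-,+)\<close> is the third.
\<close>

lemma cq_conj_third:
  assumes "{i, j, k} \<subseteq> {1, 2, 3}" and "i \<noteq> j" and "j \<noteq> k" and "i \<noteq> k"
  shows "cq_conj j (cq_conj i q) = cq_conj k q"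
  using assms by (auto simp: cq_conj_def cquat_eq_iff)

section \<open>Conjugates and conjugate transposes of matrices\<close>

lemma transpose_mat_conj: "transpose (mat_conj i A) = mat_conj i (transpose A)"
  by (simp add: mat_conj_def transpose_def vec_eq_iff)

lemma mat_conj_one:
  assumes "i \<in> {1, 2, 3}"
  shows "mat_conj i (mat 1) = mat 1"
  using assms by (simp add: mat_conj_def mat_def vec_eq_iff cq_conj_0 cq_conj_1)

lemma mat_conj_mult:
  assumes "i \<in> {1, 2, 3}"
  shows "mat_conj i (A ** B) = mat_conj i A ** mat_conj i B"
  using assms
  by (simp add: mat_conj_def matrix_matrix_mult_def vec_eq_iff cq_conj_sum cq_conj_mult)

lemma mat_dagger_one:
  assumes "i \<in> {1, 2, 3}"
  shows "mat_dagger i (mat 1) = mat 1"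
  using assms by (simp add: mat_dagger_def mat_conj_one)

lemma mat_dagger_mult:
  assumes "i \<in> {1, 2, 3}"
  shows "mat_dagger i (A ** B) = mat_dagger i B ** mat_dagger i A"
  using assms by (simp add: mat_dagger_def mat_conj_mult matrix_transpose_mul)

lemma matrix_inv_mat_conj:
  assumes i: "i \<in> {1, 2, 3}" and A: "invertible A"
  shows "invertible (mat_conj i A)" and "matrix_inv (mat_conj i A) = mat_conj i (matrix_inv A)"
proof -
  have 1: "mat_conj i A ** mat_conj i (matrix_inv A) = mat 1"
    by (metis A i mat_conj_mult mat_conj_one matrix_inv_inverse(1))
  have 2: "mat_conj i (matrix_inv A) ** mat_conj i A = mat 1"
    by (metis A i mat_conj_mult mat_conj_one matrix_inv_inverse(2))
  show "invertible (mat_conj i A)" and "matrix_inv (mat_conj i A) = mat_conj i (matrix_inv A)"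
    using matrix_inv_unique[OF 1 2] by auto
qed

text \<open>
  As \<open>\<dagger>\<^sub>i\<close> reverses products, it interchanges the two equations that
  make \<open>matrix_inv A\<close> an inverse of \<open>A\<close>.
\<close>

lemma matrix_inv_mat_dagger:
  assumes i: "i \<in> {1, 2, 3}" and A: "invertible A"
  shows "invertible (mat_dagger i A)"
    and "matrix_inv (mat_dagger i A) = mat_dagger i (matrix_inv A)"
proof -
  have 1: "mat_dagger i A ** mat_dagger i (matrix_inv A) = mat 1"
    by (metis A i mat_dagger_mult mat_dagger_one matrix_inv_inverse(2))
  have 2: "mat_dagger i (matrix_inv A) ** mat_dagger i A = mat 1"
    by (metis A i mat_dagger_mult mat_dagger_one matrix_inv_inverse(1))
  show "invertible (mat_dagger i A)"
    and "matrix_inv (mat_dagger i A) = mat_dagger i (matrix_inv A)"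
    using matrix_inv_unique[OF 1 2] by auto
qed

lemma mat_conj_involution:
  assumes "i \<in> {1, 2, 3}"
  shows "mat_conj i (mat_conj i A) = A"
  using assms by (simp add: mat_conj_def vec_eq_iff cq_conj_involution)

lemma mat_conj_third:
  assumes "{i, j, k} \<subseteq> {1, 2, 3}" and "i \<noteq> j" and "j \<noteq> k" and "i \<noteq> k"
  shows "mat_conj j (mat_conj i A) = mat_conj k A"
  using cq_conj_third[OF assms] by (simp add: mat_conj_def vec_eq_iff)

theorem theorem4p1:
  fixes A :: "cquat ^ 'n ^ 'm" and B :: "cquat ^ 'p ^ 'n"
    and C D :: "cquat ^ 'n ^ 'n"
    and i :: nat
  assumes i: "i \<in> {1, 2, 3}"
  shows "transpose (mat_conj i A) = mat_conj i (transpose A) \<and>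
    mat_dagger i (A ** B) = mat_dagger i B ** mat_dagger i A \<and>
    transpose (A ** B) = transpose B ** transpose A \<and>
    mat_conj i (A ** B) = mat_conj i A ** mat_conj i B \<and>
    (invertible C \<and> invertible D \<longrightarrow>
       invertible (C ** D) \<and> matrix_inv (C ** D) = matrix_inv D ** matrix_inv C) \<and>
    (invertible C \<longrightarrow>
       invertible (mat_dagger i C) \<and>
       matrix_inv (mat_dagger i C) = mat_dagger i (matrix_inv C)) \<and>
    (invertible C \<longrightarrow>
       invertible (mat_conj i C) \<and>
       matrix_inv (mat_conj i C) = mat_conj i (matrix_inv C)) \<and>
    (\<forall>j \<in> {1, 2, 3}. \<forall>k \<in> {1, 2, 3}.
       (i \<noteq> j \<and> j \<noteq> k \<and> i \<noteq> k \<longrightarrow> mat_conj j (mat_conj i A) = mat_conj k A) \<and>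
       (i = j \<longrightarrow> mat_conj j (mat_conj i A) = A))"
proof (intro conjI impI ballI)
  fix j k :: nat
  assume j: "j \<in> {1, 2, 3}" and k: "k \<in> {1, 2, 3}"
  show "mat_conj j (mat_conj i A) = mat_conj k A" if "i \<noteq> j \<and> j \<noteq> k \<and> i \<noteq> k"
    using mat_conj_third[of i j k A] i j k that by blast
  show "mat_conj j (mat_conj i A) = A" if "i = j"
    using mat_conj_involution[OF i] that by simp
qed (use i in \<open>simp_all only: transpose_mat_conj mat_dagger_mult matrix_transpose_mul
       mat_conj_mult matrix_inv_mult matrix_inv_mat_dagger matrix_inv_mat_conj\<close>)

end
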